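(* Let $\mathcal{M}=\{p_\theta : \theta\in\Theta\}$ be a regular uniparametric statistical model, where $\Theta\subset\mathbb{R}$ is an open interval, with Fisher metric $g(\theta)=[g_{11}(\theta)]$, $g_{11}(\theta)>0$. Let $h_g:\Theta\to\mathbb{R}$ be an antiderivative of $\theta\mapsto\sqrt{g_{11}(\theta)}$. Then for all $\theta_0,\theta_1\in\Theta$ the Fisher-Rao distance between $p_{\theta_0}$ and $p_{\theta_1}$ is $$\rho(\theta_0,\theta_1)=\left|h_g(\theta_0)-h_g(\theta_1)\right|.$$
   Context: A statistical model is a family of probability densities $p_\theta$ with respect to a fixed positive measure, indexed by $\theta$ in a connected open set $\Theta\subset\mathbb{R}^m$; it is assumed regular, so that the Fisher information matrix $I(\theta)=[g_{ij}(\theta)]$, $g_{ij}(\theta)=E_{p_\theta}[\partial_i\log p_\theta(x)\,\partial_j\log p_\theta(x)]$, is well defined, positive-definite and smooth in $\theta$. The Fisher metric is the Riemannian metric on $\Theta$ with matrix $I(\theta)$. The Fisher-Rao distance $\rho(\theta_0,\theta_1)$ is the Riemannian distance of this metric: the infimum of $\int_0^1\sqrt{\dot c(t)^\top I(c(t))\,\dot c(t)}\,dt$ over piecewise smooth curves $c:[0,1]\to\Theta$ with $c(0)=\theta_0$, $c(1)=\theta_1$. *)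

theory Defs
  imports "HOL-Probability.Probability"
begin

text \<open>
  Derivatives are taken within \<open>S\<close>, so that the definition applies both to open sets, where
  \<open>at x within S\<close> is \<open>at x\<close>, and to nondegenerate compact intervals, where the derivatives at
  the endpoints are one-sided. On sets where derivatives within \<open>S\<close> are not unique (for instance
  sets with isolated points) it is not meaningful.
\<close>

primrec Ck_on :: "nat \<Rightarrow> ('a::euclidean_space \<Rightarrow> 'b::real_normed_vector) \<Rightarrow> 'a set \<Rightarrow> bool" where
  "Ck_on 0 f S \<longleftrightarrow> continuous_on S f"
| "Ck_on (Suc k) f S \<longleftrightarrow>
     f differentiable_on S \<and>
     (\<forall>i\<in>Basis. Ck_on k (\<lambda>x. frechet_derivative f (at x within S) i) S)"

definition smooth_on :: "'a set \<Rightarrow> ('a::euclidean_space \<Rightarrow> 'b::real_normed_vector) \<Rightarrow> bool" where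
  "smooth_on S f \<longleftrightarrow> (\<forall>k. Ck_on k f S)"

text \<open>
  Each closed piece is smooth up to and including its endpoints. This is stronger than being
  continuous and smooth off a finite set, which would allow the velocity to blow up.
\<close>

definition piecewise_smooth_curve :: "(real \<Rightarrow> 'a::euclidean_space) \<Rightarrow> bool" where
  "piecewise_smooth_curve c \<longleftrightarrow>
     continuous_on {0..1} c \<and>
     (\<exists>(n::nat) \<tau>. \<tau> 0 = (0::real) \<and> \<tau> n = 1 \<and>
        (\<forall>k<n. \<tau> k < \<tau> (Suc k) \<and> smooth_on {\<tau> k..\<tau> (Suc k)} c))"

definition partial_deriv :: "'a::euclidean_space \<Rightarrow> ('a \<Rightarrow> real) \<Rightarrow> 'a \<Rightarrow> real" where
  "partial_deriv i f \<theta> = deriv (\<lambda>t. f (\<theta> + t *\<^sub>R i)) 0"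

text \<open>
  A family of densities with respect to \<open>M\<close> is given by \<open>p\<close>, where \<open>p \<theta> x\<close> is the value at \<open>x\<close>
  of the density with parameter \<open>\<theta>\<close>. Coordinates of the parameter are indexed by \<open>Basis\<close>; for a
  real parameter the only index is \<open>1\<close>.
\<close>

definition model_measure :: "'x measure \<Rightarrow> ('a \<Rightarrow> 'x \<Rightarrow> real) \<Rightarrow> 'a \<Rightarrow> 'x measure" where
  "model_measure M p \<theta> = density M (\<lambda>x. ennreal (p \<theta> x))"

definition score ::
  "('a::euclidean_space \<Rightarrow> 'x \<Rightarrow> real) \<Rightarrow> 'a \<Rightarrow> 'a \<Rightarrow> 'x \<Rightarrow> real" where
  "score p i \<theta> x = partial_deriv i (\<lambda>\<eta>. ln (p \<eta> x)) \<theta>"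

definition fisher_info ::
  "'x measure \<Rightarrow> ('a::euclidean_space \<Rightarrow> 'x \<Rightarrow> real) \<Rightarrow> 'a \<Rightarrow> 'a \<Rightarrow> 'a \<Rightarrow> real" where
  "fisher_info M p i j \<theta> = (LINT x|model_measure M p \<theta>. score p i \<theta> x * score p j \<theta> x)"

definition fisher_metric ::
  "'x measure \<Rightarrow> ('a::euclidean_space \<Rightarrow> 'x \<Rightarrow> real) \<Rightarrow> 'a \<Rightarrow> 'a \<Rightarrow> 'a \<Rightarrow> real" where
  "fisher_metric M p \<theta> u v =
     (\<Sum>i\<in>Basis. \<Sum>j\<in>Basis. (u \<bullet> i) * fisher_info M p i j \<theta> * (v \<bullet> j))"

text \<open>
  In \<open>score_exists\<close>, positivity near \<open>\<theta>\<close> is required because \<open>ln 0 = 0\<close> could otherwise make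
  \<open>\<lambda>t. ln (p (\<theta> + t *\<^sub>R i) x)\<close> differentiable although the logarithm of the density is not.
\<close>

locale regular_statistical_model =
  fixes M :: "'x measure"
    and \<Theta> :: "'a::euclidean_space set"
    and p :: "'a \<Rightarrow> 'x \<Rightarrow> real"
  assumes open_params: "open \<Theta>"
    and connected_params: "connected \<Theta>"
    and density_measurable: "\<And>\<theta>. \<theta> \<in> \<Theta> \<Longrightarrow> p \<theta> \<in> borel_measurable M"
    and density_nonneg: "\<And>\<theta> x. \<theta> \<in> \<Theta> \<Longrightarrow> x \<in> space M \<Longrightarrow> 0 \<le> p \<theta> x"
    and density_prob: "\<And>\<theta>. \<theta> \<in> \<Theta> \<Longrightarrow> prob_space (model_measure M p \<theta>)"
    and score_exists: "\<And>\<theta> i. \<theta> \<in> \<Theta> \<Longrightarrow> i \<in> Basis \<Longrightarrow>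
      AE x in model_measure M p \<theta>.
        (\<forall>\<^sub>F t in nhds 0. 0 < p (\<theta> + t *\<^sub>R i) x) \<and>
        (\<lambda>t. ln (p (\<theta> + t *\<^sub>R i) x)) differentiable (at 0)"
    and score_integrable: "\<And>\<theta> i j. \<theta> \<in> \<Theta> \<Longrightarrow> i \<in> Basis \<Longrightarrow> j \<in> Basis \<Longrightarrow>
      integrable (model_measure M p \<theta>) (\<lambda>x. score p i \<theta> x * score p j \<theta> x)"
    and fisher_pos_def: "\<And>\<theta> u. \<theta> \<in> \<Theta> \<Longrightarrow> u \<noteq> 0 \<Longrightarrow> 0 < fisher_metric M p \<theta> u u"
    and fisher_smooth: "\<And>i j. i \<in> Basis \<Longrightarrow> j \<in> Basis \<Longrightarrow> smooth_on \<Theta> (fisher_info M p i j)"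

text \<open>
  The integrand of the length is unspecified at the finitely many break points, and at \<open>0\<close> and
  \<open>1\<close>, which does not affect the integral.
\<close>

definition fisher_length ::
  "'x measure \<Rightarrow> ('a::euclidean_space \<Rightarrow> 'x \<Rightarrow> real) \<Rightarrow> (real \<Rightarrow> 'a) \<Rightarrow> real" where
  "fisher_length M p c =
     integral {0..1} (\<lambda>t. sqrt (fisher_metric M p (c t)
       (vector_derivative c (at t)) (vector_derivative c (at t))))"

definition fisher_rao_dist ::
  "'x measure \<Rightarrow> 'a set \<Rightarrow> ('a::euclidean_space \<Rightarrow> 'x \<Rightarrow> real) \<Rightarrow> 'a \<Rightarrow> 'a \<Rightarrow> real" where
  "fisher_rao_dist M \<Theta> p \<theta>0 \<theta>1 =
     Inf {fisher_length M p c | c.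
       piecewise_smooth_curve c \<and> c ` {0..1} \<subseteq> \<Theta> \<and> c 0 = \<theta>0 \<and> c 1 = \<theta>1}"

lemma fisher_metric_real:
  fixes p :: "real \<Rightarrow> 'x \<Rightarrow> real"
  shows "fisher_metric M p \<theta> u v = u * fisher_info M p 1 1 \<theta> * v"
  by (simp add: fisher_metric_def)

end

(* The antiderivative h turns the speed along a curve c into |(h o c)'|, so every admissible
   curve has length at least |h (c 1) - h (c 0)|, and the segment from one parameter to the
   other, along which h o c is monotone, attains this bound. *)

theory Submission
  imports Defs
begin

text \<open>Induction on \<open>k\<close> with \<open>f\<close> and \<open>d\<close> arbitrary: the
  derivative of such an \<open>f\<close> is again constant on the interval, with value 0. Constancy
  is asked for on \<open>{a..b}\<close> only, since the derivative within the interval is determined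
  only there.\<close>

lemma Ck_on_const_on:
  fixes a b :: real
  assumes "a < b" "\<And>x. x \<in> {a..b} \<Longrightarrow> f x = d"
  shows "Ck_on k f {a..b}"
  using assms(2)
proof (induction k arbitrary: f d)
  case 0
  then have "continuous_on {a..b} f \<longleftrightarrow> continuous_on {a..b} (\<lambda>_. d)"
    by (intro continuous_on_cong) auto
  then show ?case
    by simp
next
  case (Suc k)
  have der: "(f has_derivative (\<lambda>_. 0)) (at x within {a..b})" if "x \<in> {a..b}" for x
    using that Suc.prems by (rule has_derivative_transform) auto
  \<comment> \<open>\<open>frechet_derivative\<close> chooses some derivative; \<open>a < b\<close>
    makes derivatives within the interval unique, endpoints included, so the choice must be
    zero.\<close>
  have "frechet_derivative f (at x within {a..b}) = (\<lambda>_. 0)" if "x \<in> {a..b}" for x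
    using frechet_derivative_within_cbox[of a b x f] der[OF that] that \<open>a < b\<close> by simp
  then have "Ck_on k (\<lambda>x. frechet_derivative f (at x within {a..b}) i) {a..b}" for i
    by (intro Suc.IH[where d = 0]) simp
  then show ?case
    unfolding Ck_on.simps differentiable_on_def differentiable_def using der by blast
qed

text \<open>One differentiation leaves the constant \<open>v\<close> on the interval, and constants
  have all further derivatives.\<close>

lemma smooth_on_affine:
  fixes a b :: real and v w :: "'b::real_normed_vector"
  assumes "a < b"
  shows "smooth_on {a..b} (\<lambda>t. w + t *\<^sub>R v)"
proof -
  have der: "((\<lambda>t. w + t *\<^sub>R v) has_derivative (\<lambda>t. t *\<^sub>R v)) (at x within {a..b})" for x :: real
    by (auto intro!: derivative_eq_intros)
  have D: "frechet_derivative (\<lambda>t. w + t *\<^sub>R v) (at x within {a..b}) 1 = v"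
    if "x \<in> {a..b}" for x
    using frechet_derivative_within_cbox[of a b x, unfolded box_real, OF _ that der] assms by simp
  have "Ck_on k (\<lambda>t. w + t *\<^sub>R v) {a..b}" for k
  proof (cases k)
    case 0
    then show ?thesis by (auto intro!: continuous_intros)
  next
    case (Suc j)
    then show ?thesis
      using Ck_on_const_on[OF assms D] der
      by (auto simp: differentiable_on_def differentiable_def)
  qed
  then show ?thesis
    by (simp add: smooth_on_def)
qed

lemma piecewise_smooth_curve_affine:
  "piecewise_smooth_curve (\<lambda>t. w + t *\<^sub>R v)"
proof -
  have "\<exists>(n::nat) \<tau>. \<tau> 0 = (0::real) \<and> \<tau> n = 1 \<and>
      (\<forall>k<n. \<tau> k < \<tau> (Suc k) \<and> smooth_on {\<tau> k..\<tau> (Suc k)} (\<lambda>t. w + t *\<^sub>R v))"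
    \<comment> \<open>A single piece suffices: \<open>real\<close> sends the indices 0 and 1 to the
      break points 0 and 1.\<close>
    by (rule exI[of _ 1], rule exI[of _ real]) (simp add: smooth_on_affine)
  then show ?thesis
    unfolding piecewise_smooth_curve_def by (auto intro!: continuous_intros)
qed

lemma has_vector_derivative_antideriv_comp:
  fixes h :: "real \<Rightarrow> real"
  assumes "(h has_real_derivative s) (at (c t))" "(c has_vector_derivative d) (at t)"
  shows "((\<lambda>t. h (c t)) has_vector_derivative s * d) (at t)"
  using DERIV_chain2[of h s c t d UNIV] assms
  by (simp add: has_real_derivative_iff_has_vector_derivative)

text \<open>In dimension one the squared speed has the form \<open>d * s * d\<close>. The real
  \<open>sqrt\<close> is extended to negative numbers as an odd function and so is multiplicative
  for either sign of \<open>s\<close>.\<close>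

lemma sqrt_mult_sandwich: "sqrt (d * s * d) = sqrt s * \<bar>d\<bar>"
proof -
  have "d * s * d = s * (d * d)"
    by simp
  then show ?thesis
    by (simp only: real_sqrt_mult[of s] real_sqrt_abs2)
qed

text \<open>Inside the interval, \<open>F\<close> is the absolute value of the derivative of
  \<open>h\<close> along \<open>c\<close>, so the bound is the estimate of the norm of an integral
  by the integral of the norm.\<close>

lemma speed_integral_ge_smooth:
  fixes c g h :: "real \<Rightarrow> real"
  assumes "a < b" "smooth_on {a..b} c" "c ` {a..b} \<subseteq> \<Theta>"
    and g: "continuous_on \<Theta> g" "\<And>\<theta>. \<theta> \<in> \<Theta> \<Longrightarrow> 0 \<le> g \<theta>"
    and h: "\<And>\<theta>. \<theta> \<in> \<Theta> \<Longrightarrow> (h has_real_derivative sqrt (g \<theta>)) (at \<theta>)"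
  defines "F \<equiv> \<lambda>t. sqrt (vector_derivative c (at t) * g (c t) * vector_derivative c (at t))"
  shows "F integrable_on {a..b}" "\<bar>h (c b) - h (c a)\<bar> \<le> integral {a..b} F"
proof -
  \<comment> \<open>The two-sided derivative in \<open>F\<close> may fail to exist at
    \<open>a\<close> and \<open>b\<close>, where pieces can meet in a corner. \<open>D\<close> is
    one-sided there and continuous on all of \<open>{a..b}\<close>.\<close>
  define D where "D t = frechet_derivative c (at t within {a..b}) 1" for t
  have "Ck_on (Suc 0) c {a..b}"
    using assms(2) unfolding smooth_on_def by blast
  then have diff: "c differentiable_on {a..b}" and D: "continuous_on {a..b} D"
    by (simp_all add: D_def[abs_def])
  have c: "continuous_on {a..b} c"
    using diff by (rule differentiable_imp_continuous_on)
  have vd: "(c has_vector_derivative D t) (at t)" if "t \<in> {a<..<b}" for t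
  proof -
    have "at t within {a..b} = at t"
      using that by (intro at_within_interior) simp
    then have "D t = frechet_derivative c (at t) 1" and "c differentiable (at t)"
      using diff[unfolded differentiable_on_def, rule_format, of t] that by (simp_all add: D_def)
    moreover from this have "D t = vector_derivative c (at t)"
      by (simp add: frechet_derivative_eq_vector_derivative)
    ultimately show ?thesis
      by (simp add: vector_derivative_works)
  qed
  have F: "F t = sqrt (g (c t)) * \<bar>D t\<bar>" if "t \<in> {a<..<b}" for t
    using vector_derivative_at[OF vd[OF that]]
    by (simp add: F_def sqrt_mult_sandwich)
  have gc: "continuous_on {a..b} (\<lambda>t. g (c t))"
    using continuous_on_compose2[OF g(1) c assms(3)] .
  have "(\<lambda>t. sqrt (g (c t)) * \<bar>D t\<bar>) integrable_on {a..b}"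
    by (intro integrable_continuous_real continuous_intros gc D)
  moreover have neg: "negligible {a, b}"
    by simp
  ultimately show int: "F integrable_on {a..b}"
    by (rule integrable_spike) (auto simp: F)
  have hc: "continuous_on {a..b} (\<lambda>t. h (c t))"
  proof (rule continuous_on_compose2[OF _ c assms(3)])
    show "continuous_on \<Theta> h"
      using h DERIV_isCont continuous_at_imp_continuous_on by blast
  qed
  \<comment> \<open>This form of the fundamental theorem needs derivatives in the interior only, and
    continuity up to the endpoints.\<close>
  have "((\<lambda>t. sqrt (g (c t)) * D t) has_integral h (c b) - h (c a)) {a..b}"
    using \<open>a < b\<close> assms(3) hc
    by (intro fundamental_theorem_of_calculus_interior has_vector_derivative_antideriv_comp h vd)
      auto
  \<comment> \<open>At \<open>a\<close> and \<open>b\<close> nothing but the sign of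
    \<open>F\<close> is known, so the integrand is reset to 0 there to make the pointwise bound by
    \<open>F\<close> hold on all of \<open>{a..b}\<close>.\<close>
  then have hi: "((\<lambda>t. if t \<in> {a, b} then 0 else sqrt (g (c t)) * D t) has_integral
      h (c b) - h (c a)) {a..b}"
    by (rule has_integral_spike[OF neg, rotated]) simp
  have "norm (if t \<in> {a, b} then 0 else sqrt (g (c t)) * D t) \<le> F t"
    if "t \<in> {a..b}" for t
  proof (cases "t \<in> {a, b}")
    case True
    have "0 \<le> g (c t)"
      using that assms(3) g(2) by blast
    then show ?thesis
      using True by (simp add: F_def sqrt_mult_sandwich)
  next
    case False
    have "0 \<le> g (c t)"
      using that assms(3) g(2) by blast
    then show ?thesis
      using False F that by (simp add: abs_mult)
  qed
  from integral_norm_bound_integral[OF has_integral_integrable[OF hi] int this]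
  show "\<bar>h (c b) - h (c a)\<bar> \<le> integral {a..b} F"
    by (simp only: integral_unique[OF hi] real_norm_def)
qed

text \<open>Induction along the break points: the integrals over the pieces add up, and the triangle
  inequality adds up the increments of \<open>h\<close> along \<open>c\<close>.\<close>

lemma speed_integral_ge:
  fixes c g h :: "real \<Rightarrow> real"
  assumes "piecewise_smooth_curve c" "c ` {0..1} \<subseteq> \<Theta>"
    and g: "continuous_on \<Theta> g" "\<And>\<theta>. \<theta> \<in> \<Theta> \<Longrightarrow> 0 \<le> g \<theta>"
    and h: "\<And>\<theta>. \<theta> \<in> \<Theta> \<Longrightarrow> (h has_real_derivative sqrt (g \<theta>)) (at \<theta>)"
  defines "F \<equiv> \<lambda>t. sqrt (vector_derivative c (at t) * g (c t) * vector_derivative c (at t))"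
  shows "\<bar>h (c 1) - h (c 0)\<bar> \<le> integral {0..1} F"
proof -
  obtain n \<tau> where \<tau>: "\<tau> 0 = (0::real)" "\<tau> n = 1"
    and less: "\<And>k. k < n \<Longrightarrow> \<tau> k < \<tau> (Suc k)"
    and smooth: "\<And>k. k < n \<Longrightarrow> smooth_on {\<tau> k..\<tau> (Suc k)} c"
    using assms(1) unfolding piecewise_smooth_curve_def by blast
  have mono: "\<tau> i \<le> \<tau> j" if "i \<le> j" "j \<le> n" for i j
    using that
  proof (induction rule: dec_induct)
    case (step k)
    then show ?case using less[of k] by simp
  qed simp
  \<comment> \<open>Integrability is carried through the induction because additivity of the
    integral depends on it.\<close>
  have "F integrable_on {0..\<tau> k} \<and> \<bar>h (c (\<tau> k)) - h (c 0)\<bar> \<le> integral {0..\<tau> k} F"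
    if "k \<le> n" for k
    using that
  proof (induction k)
    case 0
    then show ?case using integrable_on_refl[of F 0] by (simp add: \<tau>)
  next
    case (Suc k)
    have le: "0 \<le> \<tau> k" "\<tau> k < \<tau> (Suc k)" "\<tau> (Suc k) \<le> 1"
      using mono[of 0 k] less[of k] mono[of "Suc k" n] \<tau> Suc.prems by auto
    have "c ` {\<tau> k..\<tau> (Suc k)} \<subseteq> \<Theta>"
      using assms(2) le by (force simp: image_subset_iff)
    note piece = speed_integral_ge_smooth[OF le(2) smooth[OF Suc_le_lessD[OF Suc.prems]] this g h, folded F_def]
    have int: "F integrable_on {0..\<tau> (Suc k)}"
      using Suc.IH[OF Suc_leD[OF Suc.prems]] piece(1)
      by (intro Henstock_Kurzweil_Integration.integrable_combine[OF le(1) less_imp_le[OF le(2)]])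
        auto
    have "integral {0..\<tau> k} F + integral {\<tau> k..\<tau> (Suc k)} F = integral {0..\<tau> (Suc k)} F"
      by (rule Henstock_Kurzweil_Integration.integral_combine[OF le(1) less_imp_le[OF le(2)] int])
    then show ?case
      using int Suc.IH[OF Suc_leD[OF Suc.prems]] piece(2) by linarith
  qed
  from this[of n] show ?thesis
    by (simp add: \<tau>)
qed

text \<open>The velocity \<open>y - x\<close> has constant sign and the derivative of
  \<open>h\<close> is nonnegative, so the increments of \<open>h\<close> along the segment cannot
  cancel.\<close>

lemma speed_integral_segment:
  fixes g h :: "real \<Rightarrow> real"
  assumes "is_interval \<Theta>" "x \<in> \<Theta>" "y \<in> \<Theta>"
    and g: "\<And>\<theta>. \<theta> \<in> \<Theta> \<Longrightarrow> 0 \<le> g \<theta>"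
    and h: "\<And>\<theta>. \<theta> \<in> \<Theta> \<Longrightarrow> (h has_real_derivative sqrt (g \<theta>)) (at \<theta>)"
  defines "c \<equiv> \<lambda>t. x + t *\<^sub>R (y - x)"
  shows "c ` {0..1} \<subseteq> \<Theta>"
    "integral {0..1} (\<lambda>t. sqrt (vector_derivative c (at t) * g (c t) * vector_derivative c (at t)))
      = \<bar>h x - h y\<bar>" (is "integral _ ?F = _")
proof -
  show sub: "c ` {0..1} \<subseteq> \<Theta>"
  proof
    fix z assume "z \<in> c ` {0..1}"
    then obtain t where "z = c t" "0 \<le> t" "t \<le> 1"
      by auto
    moreover have "c t = (1 - t) *\<^sub>R x + t *\<^sub>R y"
      by (simp add: c_def algebra_simps)
    ultimately show "z \<in> \<Theta>"
      using is_interval_convex[OF assms(1)] assms(2,3) by (auto simp: convex_alt)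
  qed
  have vd: "(c has_vector_derivative (y - x)) (at t within S)" for t S
    unfolding c_def by (auto intro!: derivative_eq_intros)
  have F: "?F t = sqrt (g (c t)) * \<bar>y - x\<bar>" for t
    by (simp add: vector_derivative_at[OF vd] sqrt_mult_sandwich)
  have "((\<lambda>t. sqrt (g (c t)) * (y - x)) has_integral h (c 1) - h (c 0)) {0..1}"
  proof (rule fundamental_theorem_of_calculus)
    fix t :: real assume "t \<in> {0..1}"
    then have "c t \<in> \<Theta>"
      using sub by blast
    from has_vector_derivative_antideriv_comp[where c = c, OF h[OF this] vd]
    show "((\<lambda>t. h (c t)) has_vector_derivative sqrt (g (c t)) * (y - x)) (at t within {0..1})"
      by (rule has_vector_derivative_at_within)
  qed simp
  \<comment> \<open>The factor \<open>sgn (y - x)\<close> turns \<open>y - x\<close> into its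
    absolute value, treating both directions and the case \<open>x = y\<close> at once.\<close>
  then have "((\<lambda>t. sgn (y - x) * (sqrt (g (c t)) * (y - x))) has_integral
      sgn (y - x) * (h (c 1) - h (c 0))) {0..1}"
    by (rule has_integral_mult_right)
  then have I: "(?F has_integral sgn (y - x) * (h y - h x)) {0..1}"
    unfolding F by (simp add: c_def abs_sgn mult_ac)
  \<comment> \<open>As the integral of a nonnegative function this product is nonnegative, which
    identifies it with the absolute value of the increment of \<open>h\<close>.\<close>
  moreover have "0 \<le> sgn (y - x) * (h y - h x)"
    by (rule has_integral_nonneg[OF I]) (use F sub g in \<open>auto simp: image_subset_iff\<close>)
  then have "sgn (y - x) * (h y - h x) = \<bar>h x - h y\<bar>"
    by (auto simp: sgn_if split: if_splits)
  ultimately show "integral {0..1} ?F = \<bar>h x - h y\<bar>"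
    by (simp add: integral_unique)
qed

theorem proposition1:
  fixes M :: "'x measure" and \<Theta> :: "real set"
    and p :: "real \<Rightarrow> 'x \<Rightarrow> real" and h :: "real \<Rightarrow> real"
  assumes "open \<Theta>" and "is_interval \<Theta>"
    and "regular_statistical_model M \<Theta> p"
    and "\<And>\<theta>. \<theta> \<in> \<Theta> \<Longrightarrow> (h has_real_derivative sqrt (fisher_info M p 1 1 \<theta>)) (at \<theta>)"
    and "\<theta>0 \<in> \<Theta>" and "\<theta>1 \<in> \<Theta>"
  shows "fisher_rao_dist M \<Theta> p \<theta>0 \<theta>1 = \<bar>h \<theta>0 - h \<theta>1\<bar>"
proof -
  interpret regular_statistical_model M \<Theta> p by fact
  let ?g = "fisher_info M p 1 1"
  have "Ck_on 0 ?g \<Theta>"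
    using fisher_smooth[of 1 1] unfolding smooth_on_def by simp
  then have cont: "continuous_on \<Theta> ?g"
    by simp
  \<comment> \<open>Positive definiteness is tested on the unit vector \<open>1\<close>, where the
    metric equals the Fisher information.\<close>
  have nonneg: "0 \<le> ?g \<theta>" if "\<theta> \<in> \<Theta>" for \<theta>
    using fisher_pos_def[OF that, of 1] by (simp add: fisher_metric_real)
  have len: "fisher_length M p c = integral {0..1}
      (\<lambda>t. sqrt (vector_derivative c (at t) * ?g (c t) * vector_derivative c (at t)))" for c
    by (simp add: fisher_length_def fisher_metric_real)
  let ?c = "\<lambda>t. \<theta>0 + t *\<^sub>R (\<theta>1 - \<theta>0)"
  note segment = speed_integral_segment[OF assms(2,5,6) nonneg assms(4)]
  show ?thesis
    unfolding fisher_rao_dist_def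
  \<comment> \<open>The bound is shown to be a least element of the set of lengths: the segment puts
    it in the set, and the estimate for arbitrary curves makes it a lower bound.\<close>
  proof (rule cInf_eq_minimum)
    have "fisher_length M p ?c = \<bar>h \<theta>0 - h \<theta>1\<bar>"
      using segment(2) by (simp add: len)
    moreover have "piecewise_smooth_curve ?c \<and> ?c ` {0..1} \<subseteq> \<Theta> \<and> ?c 0 = \<theta>0 \<and> ?c 1 = \<theta>1"
      using piecewise_smooth_curve_affine[of \<theta>0 "\<theta>1 - \<theta>0"] segment(1) by simp
    ultimately show "\<bar>h \<theta>0 - h \<theta>1\<bar> \<in> {fisher_length M p c | c.
        piecewise_smooth_curve c \<and> c ` {0..1} \<subseteq> \<Theta> \<and> c 0 = \<theta>0 \<and> c 1 = \<theta>1}"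
      by (metis (mono_tags, lifting) mem_Collect_eq)
  next
    fix l assume "l \<in> {fisher_length M p c | c.
        piecewise_smooth_curve c \<and> c ` {0..1} \<subseteq> \<Theta> \<and> c 0 = \<theta>0 \<and> c 1 = \<theta>1}"
    then show "\<bar>h \<theta>0 - h \<theta>1\<bar> \<le> l"
      using speed_integral_ge[OF _ _ cont nonneg assms(4)]
      by (auto simp: len abs_minus_commute)
  qed
qed

end
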